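(* Let $n \ge 3$. For every non-absorbing state $M$ of the binary trust-gossip dynamics on $n$ agents, there exists a finite sequence of firing moves starting from $M$ that reaches either an absorbing state, or a state $M'$ with $|R(M')| < |R(M)|$.
   Context: Fix $n \ge 3$ agents. A state is a directed binary matrix $M$ with an entry $M_{ij} \in \{0,1\}$ for each ordered pair of distinct agents $(i,j)$; diagonal entries are undefined. Write $i(j)$ for $M_{ij}$, agent $i$'s opinion of agent $j$; "$i$ trusts $j$" means $i(j)=1$. View $M$ as a directed graph with an edge $i \to j$ whenever $i(j)=1$. Firing move: for distinct agents $a$ (speaker), $z$ (listener), $y$ (target) with $z(a)=1$ and $z(y) \ne a(y)$ in the current state, the move sets $z(y) := a(y)$ and changes no other entry. A state is absorbing if no firing move is available in it, i.e. for every triple $(a,z,y)$ of distinct agents, $z(a)=0$ or $z(y)=a(y)$. Reachability: for $u \ne v$, $R(M)_{uv}=1$ iff there is a directed path from $u$ to $v$ of length $\ge 1$ in $M$, and $0$ otherwise (defined only off the diagonal). $|R(M)|$ is the number of ordered pairs $(u,v)$, $u \neq v$, with $R(M)_{uv}=1$. *)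

theory Defs
  imports Main "HOL-Library.Cardinality"
begin

text \<open>
  Agents are the elements of a finite type. A state is a binary matrix, where \<open>M i j\<close> means
  \<open>i(j) = 1\<close>. Only off-diagonal entries carry meaning: the (formally present) values \<open>M i i\<close>
  stand for undefined entries, and no definition below reads or changes them.
\<close>

type_synonym 'n state = "'n \<Rightarrow> 'n \<Rightarrow> bool"

definition edges :: "'n state \<Rightarrow> ('n \<times> 'n) set" where
  "edges M = {(i, j). i \<noteq> j \<and> M i j}"

definition can_fire :: "'n state \<Rightarrow> 'n \<Rightarrow> 'n \<Rightarrow> 'n \<Rightarrow> bool" where
  "can_fire M a z y \<longleftrightarrow> a \<noteq> z \<and> a \<noteq> y \<and> z \<noteq> y \<and> M z a \<and> M z y \<noteq> M a y"

definition fire :: "'n state \<Rightarrow> 'n \<Rightarrow> 'n \<Rightarrow> 'n \<Rightarrow> 'n state" where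
  "fire M a z y = M(z := (M z)(y := M a y))"

definition firing_move :: "'n state \<Rightarrow> 'n state \<Rightarrow> bool" where
  "firing_move M M' \<longleftrightarrow> (\<exists>a z y. can_fire M a z y \<and> M' = fire M a z y)"

definition absorbing :: "'n state \<Rightarrow> bool" where
  "absorbing M \<longleftrightarrow> (\<nexists>a z y. can_fire M a z y)"

definition reachability :: "'n state \<Rightarrow> ('n \<times> 'n) set" where
  "reachability M = {(u, v). u \<noteq> v \<and> (u, v) \<in> (edges M)\<^sup>+}"

end

theory Submission
  imports Defs
begin

text \<open>
  A firing move never creates new reachability: an edge \<open>z \<rightarrow> y\<close> is only added when the path
  \<open>z \<rightarrow> a \<rightarrow> y\<close> is already there (\<open>reachability_firing_moves\<close>). Adding such edges for as long as
  possible leads to a state \<open>N\<close> with the same reachability relation as the initial one and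
  a transitive edge relation (\<open>ex_transitive_state\<close>).

  If \<open>N\<close> is absorbing, nothing remains to be done. Otherwise some move \<open>(a, z, y)\<close> can fire in \<open>N\<close>,
  and by transitivity it must be a deletion: \<open>z\<close> trusts \<open>a\<close> and \<open>y\<close>, but \<open>a\<close> does not trust \<open>y\<close>.
  Deleting \<open>z \<rightarrow> y\<close> alone may leave a detour from \<open>z\<close> to \<open>y\<close>. Instead \<open>z\<close> adopts all opinions of \<open>a\<close>
  (\<open>firing_moves_copy_row\<close>). Afterwards \<open>z\<close> trusts only \<open>a\<close> and agents trusted by \<open>a\<close>, and by
  transitivity no path leads from these agents to \<open>y\<close>. So the pair \<open>(z, y)\<close> has left the
  reachability relation, and no pair has joined it (\<open>reachability_decreases_of_transitive\<close>).
\<close>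

text \<open>
  The case \<open>u = w\<close> is excluded because mutual trust would otherwise force a diagonal entry, which
  carries no meaning.
\<close>

definition transitive_state :: "'n state \<Rightarrow> bool" where
  "transitive_state M \<longleftrightarrow> (\<forall>u v w. u \<noteq> v \<and> v \<noteq> w \<and> u \<noteq> w \<and> M u v \<and> M v w \<longrightarrow> M u w)"

lemma transitive_stateD:
  assumes "transitive_state M" "M u v" "M v w" "u \<noteq> v" "v \<noteq> w" "u \<noteq> w"
  shows "M u w"
  using assms unfolding transitive_state_def by blast

lemma edges_fire_subset:
  assumes "can_fire M a z y"
  shows "edges (fire M a z y) \<subseteq> (edges M)\<^sup>+"
proof
  fix e assume e: "e \<in> edges (fire M a z y)"
  show "e \<in> (edges M)\<^sup>+"
  proof (cases "e = (z, y)")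
    case True
    with e assms have "(z, a) \<in> edges M" "(a, y) \<in> edges M"
      by (auto simp: edges_def fire_def can_fire_def)
    with True show ?thesis by auto
  next
    case False
    with e have "e \<in> edges M"
      by (auto simp: edges_def fire_def split: if_splits)
    then show ?thesis by (rule r_into_trancl')
  qed
qed

lemma reachability_mono:
  assumes "edges M' \<subseteq> (edges M)\<^sup>+"
  shows "reachability M' \<subseteq> reachability M"
proof -
  have "(edges M')\<^sup>+ \<subseteq> ((edges M)\<^sup>+)\<^sup>+"
    using assms by (rule trancl_mono_subset)
  then show ?thesis by (auto simp: reachability_def)
qed

lemma reachability_firing_moves:
  assumes "firing_move\<^sup>*\<^sup>* M M'"
  shows "reachability M' \<subseteq> reachability M"
  using assms
proof induction
  case (step N N')
  from \<open>firing_move N N'\<close> obtain a z y where "can_fire N a z y" "N' = fire N a z y"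
    by (auto simp: firing_move_def)
  then have "reachability N' \<subseteq> reachability N"
    by (simp add: edges_fire_subset reachability_mono)
  with step.IH show ?case by simp
qed simp

text \<open>
  Among the states that moves can lead to without loss of reachability, one with the most edges is
  transitive: a missing shortcut could still be added by a move, and adding edges does not
  destroy reachability.
\<close>

lemma ex_transitive_state:
  fixes M :: "'n::finite state"
  obtains N where "firing_move\<^sup>*\<^sup>* M N" "reachability N = reachability M" "transitive_state N"
proof -
  define P where "P N \<longleftrightarrow> firing_move\<^sup>*\<^sup>* M N \<and> reachability N = reachability M" for N
  have "P M" by (simp add: P_def)
  moreover have "\<forall>N. P N \<longrightarrow> card (edges N) < Suc (card (UNIV :: ('n \<times> 'n) set))"
    by (simp add: less_Suc_eq_le card_mono del: card_prod UNIV_Times_UNIV)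
  ultimately obtain N where N: "P N" and max: "\<And>N'. P N' \<Longrightarrow> card (edges N') \<le> card (edges N)"
    using ex_has_greatest_nat[of P M "\<lambda>N. card (edges N)"] by blast
  have "N u w" if "u \<noteq> v" "v \<noteq> w" "u \<noteq> w" "N u v" "N v w" for u v w
  proof (rule ccontr)
    assume "\<not> N u w"
    with that have can: "can_fire N v u w" by (simp add: can_fire_def)
    let ?N' = "fire N v u w"
    have edges: "edges ?N' = insert (u, w) (edges N)"
      using that by (auto simp: edges_def fire_def split: if_splits)
    have move: "firing_move\<^sup>*\<^sup>* N ?N'"
      using can unfolding firing_move_def by blast
    have "reachability N \<subseteq> reachability ?N'"
      by (rule reachability_mono) (auto simp: edges)
    with move have "reachability ?N' = reachability N"
      using reachability_firing_moves by blast
    with N move have "P ?N'" by (auto simp: P_def)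
    then have "card (edges ?N') \<le> card (edges N)" by (rule max)
    moreover have "(u, w) \<notin> edges N" using \<open>\<not> N u w\<close> by (simp add: edges_def)
    ultimately show False by (simp add: edges)
  qed
  with N that show ?thesis by (auto simp: P_def transitive_state_def)
qed

text \<open>
  The speaker's row does not change while the listener copies it, and the listener's trust in the
  speaker is never a target. So the opinions can be copied one at a time.
\<close>

lemma firing_moves_copy_row:
  fixes M :: "'n state"
  assumes "finite W" "a \<notin> W" "z \<notin> W" "a \<noteq> z" "M z a"
  shows "firing_move\<^sup>*\<^sup>* M (M(z := \<lambda>w. if w \<in> W then M a w else M z w))"
  using assms
proof (induction W)
  case empty
  then show ?case by simp
next
  case (insert x W)
  let ?N = "M(z := \<lambda>w. if w \<in> W then M a w else M z w)"
  let ?N' = "M(z := \<lambda>w. if w \<in> insert x W then M a w else M z w)"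
  have N': "?N' = fire ?N a z x"
    using insert.prems by (auto simp: fire_def fun_eq_iff)
  have "firing_move\<^sup>*\<^sup>* M ?N" using insert.prems by (intro insert.IH) auto
  moreover have "firing_move\<^sup>*\<^sup>* ?N ?N'"
  proof (cases "M z x = M a x")
    case True
    then have "?N' = ?N" by (auto simp: fun_eq_iff)
    then show ?thesis by simp
  next
    case False
    with insert have "can_fire ?N a z x" by (auto simp: can_fire_def)
    then show ?thesis unfolding N' firing_move_def by blast
  qed
  ultimately show ?case by (rule rtranclp_trans)
qed

text \<open>
  Once \<open>z\<close> has copied \<open>a\<close>, the set \<open>A\<close> of \<open>a\<close> and all agents trusted by \<open>a\<close> contains everything that \<open>z\<close>
  trusts and is closed under edges. It does not contain \<open>y\<close>, so \<open>z\<close> has lost \<open>y\<close>.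
\<close>

lemma reachability_decreases_of_transitive:
  fixes M :: "'n::finite state"
  assumes trans: "transitive_state M" and "\<not> absorbing M"
  shows "\<exists>M'. firing_move\<^sup>*\<^sup>* M M' \<and> reachability M' \<subset> reachability M"
proof -
  from \<open>\<not> absorbing M\<close> obtain a z y where "can_fire M a z y"
    by (auto simp: absorbing_def)
  then have dist: "a \<noteq> z" "a \<noteq> y" "z \<noteq> y" and "M z a" and "M z y \<noteq> M a y"
    by (auto simp: can_fire_def)
  with trans have "M z y" "\<not> M a y"
    using transitive_stateD[of M z a y] by metis+
  \<comment> \<open>Otherwise \<open>a\<close> would trust \<open>y\<close> by way of \<open>z\<close>. So \<open>A\<close> below avoids \<open>z\<close>, the only row that changes.\<close>
  have "\<not> M a z"
    using transitive_stateD[of M a z y] trans dist \<open>M z y\<close> \<open>\<not> M a y\<close> by metis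
  define M' where "M' = M(z := \<lambda>w. if w \<in> - {a, z} then M a w else M z w)"
  define A where "A = insert a {w. w \<noteq> a \<and> M a w}"
  have moves: "firing_move\<^sup>*\<^sup>* M M'"
    unfolding M'_def using \<open>a \<noteq> z\<close> \<open>M z a\<close> by (intro firing_moves_copy_row) auto
  have closed: "w \<in> A" if "(u, w) \<in> edges M'" "u \<in> insert z A" for u w
  proof (cases "u = z")
    case True
    with that show ?thesis by (auto simp: edges_def M'_def A_def split: if_splits)
  next
    case False
    with that have "M u w" "u \<noteq> w" "u \<in> A" by (auto simp: edges_def M'_def)
    then show ?thesis
      using transitive_stateD[OF trans, of a u w] unfolding A_def by blast
  qed
  have "v \<in> A" if "(z, v) \<in> (edges M')\<^sup>+" for v
    using that by induction (auto intro: closed)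
  moreover have "y \<notin> A" using dist \<open>\<not> M a y\<close> by (simp add: A_def)
  ultimately have "(z, y) \<notin> reachability M'" by (auto simp: reachability_def)
  moreover have "(z, y) \<in> reachability M"
    using dist \<open>M z y\<close> by (auto simp: reachability_def edges_def)
  ultimately show ?thesis
    using moves reachability_firing_moves by blast
qed

theorem theorem1:
  fixes M :: "'n::finite state"
  assumes "CARD('n) \<ge> 3"
    and "\<not> absorbing M"
  shows "\<exists>M'. firing_move\<^sup>*\<^sup>* M M' \<and>
           (absorbing M' \<or> card (reachability M') < card (reachability M))"
proof -
  obtain N where N: "firing_move\<^sup>*\<^sup>* M N" "reachability N = reachability M" "transitive_state N"
    by (rule ex_transitive_state)
  show ?thesis
  proof (cases "absorbing N")
    case True
    with N show ?thesis by blast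
  next
    case False
    with N obtain M' where "firing_move\<^sup>*\<^sup>* N M'" "reachability M' \<subset> reachability N"
      using reachability_decreases_of_transitive by blast
    moreover from this N have "card (reachability M') < card (reachability M)"
      by (simp add: psubset_card_mono)
    ultimately show ?thesis using N(1) by (meson rtranclp_trans)
  qed
qed

end
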